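(* Let $Q\in\mathbb{R}^{n\times n}$ be symmetric positive semidefinite, let $b\in\mathbb{R}^n$ belong to the range of $Q$, let $f(x)=\frac12\langle x,Qx\rangle-\langle b,x\rangle$, let $f^*=\min_{x\in\mathbb{R}^n}f(x)$, and let $x^*$ be a minimizer of $f$. Let $S\in\mathbb{R}^{n\times n}$ be symmetric positive semidefinite and let $\{x^t\}$ be a sequence generated by Nesterov's accelerated method (as defined in the context) from the initial point $x^0\in\mathbb{R}^n$. Then $$0\le f(x^t)-f^*\le \frac{2\|x^0-x^*\|_S^2}{(t+1)^2},\qquad \text{for all } t\ge 1.$$
   Context: For a symmetric positive semidefinite matrix $A$, $\|x\|_A:=\sqrt{\langle x,Ax\rangle}$. Since $b$ lies in the range of $Q$, $f^*$ is finite and attained. Nesterov's accelerated method: given an initial point $x^0=y^1\in\mathbb{R}^n$, $\alpha_0=0$, $\alpha_1=1$ and a symmetric positive semidefinite matrix $S$, for $t=1,2,\dots$ perform: (1) $x^t\in\operatorname{argmin}_{x\in\mathbb{R}^n}\left\{\frac12\langle x,Qx\rangle-\langle b,x\rangle+\frac12\|x-y^t\|_S^2\right\}$ (any minimizer); (2) $\alpha_{t+1}=\dfrac{1+\sqrt{1+4\alpha_t^2}}{2}$; (3) $y^{t+1}=\left(1+\dfrac{\alpha_t-1}{\alpha_{t+1}}\right)x^t-\dfrac{\alpha_t-1}{\alpha_{t+1}}x^{t-1}$. *)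

theory Defs
  imports "HOL-Analysis.Analysis"
begin

definition sym_psd :: "real ^ 'n ^ 'n \<Rightarrow> bool" where
  "sym_psd A \<longleftrightarrow> transpose A = A \<and> (\<forall>x. 0 \<le> x \<bullet> (A *v x))"

definition mat_norm :: "real ^ 'n ^ 'n \<Rightarrow> real ^ 'n \<Rightarrow> real" where
  "mat_norm A x = sqrt (x \<bullet> (A *v x))"

definition quad_obj :: "real ^ 'n ^ 'n \<Rightarrow> real ^ 'n \<Rightarrow> real ^ 'n \<Rightarrow> real" where
  "quad_obj Q b x = 1/2 * (x \<bullet> (Q *v x)) - b \<bullet> x"

fun nesterov_alpha :: "nat \<Rightarrow> real" where
  "nesterov_alpha 0 = 0"
| "nesterov_alpha (Suc 0) = 1"
| "nesterov_alpha (Suc (Suc t)) = (1 + sqrt (1 + 4 * (nesterov_alpha (Suc t))\<^sup>2)) / 2"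

(* The subproblem may have several minimizers when Q + S is singular, and any of them may be
   chosen, so a run of the method is a relation on sequences rather than a function of x0.
   The value y 0 is unconstrained and plays no role. *)
definition nesterov_sequence ::
  "real ^ 'n ^ 'n \<Rightarrow> real ^ 'n \<Rightarrow> real ^ 'n ^ 'n \<Rightarrow> real ^ 'n \<Rightarrow> (nat \<Rightarrow> real ^ 'n) \<Rightarrow> bool" where
  "nesterov_sequence Q b S x0 x \<longleftrightarrow>
     (\<exists>y. x 0 = x0 \<and> y 1 = x0 \<and>
       (\<forall>t\<ge>1.
          is_arg_min (\<lambda>z. quad_obj Q b z + 1/2 * (mat_norm S (z - y t))\<^sup>2) (\<lambda>_. True) (x t) \<and>
          y (t + 1) =
            (1 + (nesterov_alpha t - 1) / nesterov_alpha (t + 1)) *\<^sub>R x t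
            - ((nesterov_alpha t - 1) / nesterov_alpha (t + 1)) *\<^sub>R x (t - 1)))"

end

theory Submission
  imports Defs
begin

text \<open>
  Minimality of \<open>x t\<close> together with convexity of \<open>f\<close> gives
  \<open>f (x t) + \<langle>z - x t, S (y t - x t)\<rangle> \<le> f z\<close> for every \<open>z\<close>. Adding this for \<open>z = x (t - 1)\<close>
  with weight \<open>\<alpha> t - 1\<close> and for \<open>z = xstar\<close> with weight \<open>1\<close>, and multiplying by \<open>\<alpha> t\<close>, shows that
  \<open>(\<alpha> t)\<^sup>2 (f (x t) - f xstar) + 1/2 \<parallel>u t\<parallel>\<^sub>S\<^sup>2\<close>
  with \<open>u t = \<alpha> t x t - (\<alpha> t - 1) x (t - 1) - xstar\<close> is nonincreasing, because
  \<open>\<alpha> t (\<alpha> t - 1) = (\<alpha> (t - 1))\<^sup>2\<close>. The rate follows from \<open>\<alpha> t \<ge> (t + 1) / 2\<close>.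
\<close>

text \<open>For small \<open>s\<close> the linear term dominates, so a nonzero \<open>G\<close>
  would give a negative value for one sign of \<open>s\<close>.\<close>

lemma linear_coeff_eq_0:
  fixes G K :: real
  assumes "\<And>s. 0 \<le> s * G + s\<^sup>2 * K"
  shows "G = 0"
proof (rule ccontr)
  assume "G \<noteq> 0"
  define c where "c = \<bar>K\<bar> + 1"
  have c: "c > 0" "K < c" by (auto simp: c_def)
  have "0 \<le> (- G / c) * G + (- G / c)\<^sup>2 * K" by (rule assms)
  also have "\<dots> = G\<^sup>2 / c\<^sup>2 * (K - c)"
    using c by (simp add: field_simps power2_eq_square)
  also have "\<dots> < 0"
    using c \<open>G \<noteq> 0\<close> by (intro mult_pos_neg) auto
  finally show False by simp
qed

lemma sym_psd_nonneg: "sym_psd A \<Longrightarrow> 0 \<le> u \<bullet> (A *v u)"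
  by (simp add: sym_psd_def)

lemma sym_psd_commute:
  assumes "sym_psd A"
  shows "u \<bullet> (A *v w) = w \<bullet> (A *v u)"
  using assms dot_lmul_matrix[of u A w]
  by (simp add: sym_psd_def inner_commute flip: transpose_matrix_vector)

lemma sym_psd_add_scaleR:
  assumes "sym_psd A"
  shows "(u + s *\<^sub>R w) \<bullet> (A *v (u + s *\<^sub>R w)) =
    u \<bullet> (A *v u) + 2 * s * (w \<bullet> (A *v u)) + s\<^sup>2 * (w \<bullet> (A *v w))"
  using sym_psd_commute[OF assms, of u w]
  by (simp add: matrix_vector_right_distrib matrix_vector_mult_scaleR inner_add_left
      inner_add_right power2_eq_square algebra_simps)

text \<open>By symmetry the right side minus the left is the quadratic form of \<open>A\<close> at
  \<open>u - w\<close>.\<close>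

lemma sym_psd_square_diff_le:
  assumes "sym_psd A"
  shows "u \<bullet> (A *v u) - w \<bullet> (A *v w) \<le> 2 * (u \<bullet> (A *v (u - w)))"
  using sym_psd_nonneg[OF assms, of "u - w"] sym_psd_commute[OF assms, of u w]
  by (simp add: matrix_vector_mult_diff_distrib inner_diff_left inner_diff_right)

lemma mat_norm_power2: "sym_psd A \<Longrightarrow> (mat_norm A u)\<^sup>2 = u \<bullet> (A *v u)"
  by (simp add: mat_norm_def sym_psd_nonneg)

lemma quad_obj_add_scaleR:
  assumes "sym_psd Q"
  shows "quad_obj Q b (u + s *\<^sub>R w) =
    quad_obj Q b u + s * (w \<bullet> (Q *v u) - b \<bullet> w) + s\<^sup>2 * (1/2 * (w \<bullet> (Q *v w)))"
  unfolding quad_obj_def sym_psd_add_scaleR[OF assms]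
  by (simp add: inner_add_right algebra_simps)

lemma proximal_step_bound:
  assumes Q: "sym_psd Q" and S: "sym_psd S"
    and min: "is_arg_min (\<lambda>z. quad_obj Q b z + 1/2 * (mat_norm S (z - y))\<^sup>2) (\<lambda>_. True) p"
  shows "quad_obj Q b p + (z - p) \<bullet> (S *v (y - p)) \<le> quad_obj Q b z"
proof -
  define d where "d = z - p"
  \<comment> \<open>Along \<open>p + s *\<^sub>R d\<close> the subproblem objective exceeds its
    value at \<open>p\<close> by exactly \<open>s * G + s\<^sup>2 * K\<close>.\<close>
  define G where "G = d \<bullet> (Q *v p) - b \<bullet> d + d \<bullet> (S *v (p - y))"
  define K where "K = 1/2 * (d \<bullet> (Q *v d)) + 1/2 * (d \<bullet> (S *v d))"
  have "0 \<le> s * G + s\<^sup>2 * K" for s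
  proof -
    have "quad_obj Q b p + 1/2 * ((p - y) \<bullet> (S *v (p - y)))
      \<le> quad_obj Q b (p + s *\<^sub>R d)
        + 1/2 * (((p - y) + s *\<^sub>R d) \<bullet> (S *v ((p - y) + s *\<^sub>R d)))"
      using min unfolding is_arg_min_def mat_norm_power2[OF S]
      by (auto simp: not_less add_diff_eq diff_add_eq)
    then show ?thesis
      unfolding quad_obj_add_scaleR[OF Q] sym_psd_add_scaleR[OF S] G_def K_def
      by (simp add: algebra_simps)
  qed
  then have "G = 0" by (rule linear_coeff_eq_0)
  moreover have "quad_obj Q b z
      = quad_obj Q b p + (d \<bullet> (Q *v p) - b \<bullet> d) + 1/2 * (d \<bullet> (Q *v d))"
    using quad_obj_add_scaleR[OF Q, of b p 1 d] by (simp add: d_def)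
  moreover have "d \<bullet> (S *v (y - p)) = - (d \<bullet> (S *v (p - y)))"
    by (simp add: matrix_vector_mult_diff_distrib inner_diff_right)
  ultimately show ?thesis
    using sym_psd_nonneg[OF Q, of d] by (simp add: G_def flip: d_def)
qed

text \<open>The recurrence also holds at \<open>t = 0\<close>, so inductions can start
  there.\<close>

lemma nesterov_alpha_Suc:
  "nesterov_alpha (Suc t) = (1 + sqrt (1 + 4 * (nesterov_alpha t)\<^sup>2)) / 2"
  by (cases t) auto

text \<open>The new value is a root of \<open>r\<^sup>2 - r = (nesterov_alpha t)\<^sup>2\<close>;
  this makes the potential estimates telescope.\<close>

lemma nesterov_alpha_Suc_identity:
  "nesterov_alpha (Suc t) * (nesterov_alpha (Suc t) - 1) = (nesterov_alpha t)\<^sup>2"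
proof -
  have "(sqrt (1 + 4 * (nesterov_alpha t)\<^sup>2))\<^sup>2 = 1 + 4 * (nesterov_alpha t)\<^sup>2"
    by simp
  then show ?thesis
    unfolding nesterov_alpha_Suc by (simp add: field_simps power2_eq_square)
qed

text \<open>Each step adds at least 1/2, since the square root is at least
  \<open>2 * nesterov_alpha (Suc t)\<close>.\<close>

lemma nesterov_alpha_Suc_ge: "(real t + 2) / 2 \<le> nesterov_alpha (Suc t)"
proof (induction t)
  case (Suc t)
  have "2 * nesterov_alpha (Suc t) \<le> sqrt (1 + 4 * (nesterov_alpha (Suc t))\<^sup>2)"
    by (rule real_le_rsqrt) (simp add: power_mult_distrib)
  with Suc show ?case by simp
qed simp

lemma nesterov_potential_step:
  assumes Q: "sym_psd Q" and S: "sym_psd S" and "1 \<le> a"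
    and min: "is_arg_min (\<lambda>z. quad_obj Q b z + 1/2 * (mat_norm S (z - y))\<^sup>2) (\<lambda>_. True) p"
    and w: "w = a *\<^sub>R y - (a - 1) *\<^sub>R q - z"
    and u: "u = a *\<^sub>R p - (a - 1) *\<^sub>R q - z"
  shows "a\<^sup>2 * (quad_obj Q b p - quad_obj Q b z) + 1/2 * (u \<bullet> (S *v u))
    \<le> a * (a - 1) * (quad_obj Q b q - quad_obj Q b z) + 1/2 * (w \<bullet> (S *v w))"
proof -
  note bound = proximal_step_bound[OF Q S min]
  define g where "g = S *v (y - p)"
  have "a * ((a - 1) * (quad_obj Q b p + (q - p) \<bullet> g) + (quad_obj Q b p + (z - p) \<bullet> g))
    \<le> a * ((a - 1) * quad_obj Q b q + quad_obj Q b z)"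
    unfolding g_def using \<open>1 \<le> a\<close> by (intro mult_left_mono add_mono bound) auto
  \<comment> \<open>The weights are chosen so that
    \<open>(a - 1) *\<^sub>R (q - p) + (z - p) = - u\<close>.\<close>
  moreover have "a * ((a - 1) * ((q - p) \<bullet> g) + (z - p) \<bullet> g) = - a * (u \<bullet> g)"
    by (simp add: u inner_diff_left algebra_simps)
  moreover have "u \<bullet> (S *v (u - w)) = - a * (u \<bullet> g)"
  proof -
    have "u - w = (- a) *\<^sub>R (y - p)" by (simp add: u w algebra_simps)
    then show ?thesis by (simp only: g_def matrix_vector_mult_scaleR inner_scaleR_right)
  qed
  moreover note sym_psd_square_diff_le[OF S, of u w]
  ultimately show ?thesis
    by (simp add: algebra_simps power2_eq_square)
qed

theorem theorem2p3:
  fixes Q S :: "real ^ 'n ^ 'n" and b x0 xstar :: "real ^ 'n" and x :: "nat \<Rightarrow> real ^ 'n"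
    and fstar :: real
  assumes Q: "sym_psd Q"
    and b: "b \<in> range (\<lambda>z. Q *v z)"
    and fstar: "fstar = (INF z. quad_obj Q b z)"
    and xstar: "is_arg_min (quad_obj Q b) (\<lambda>_. True) xstar"
    and S: "sym_psd S"
    and x: "nesterov_sequence Q b S x0 x"
  shows "\<forall>t\<ge>1. 0 \<le> quad_obj Q b (x t) - fstar \<and>
           quad_obj Q b (x t) - fstar \<le> 2 * (mat_norm S (x0 - xstar))\<^sup>2 / (real t + 1)\<^sup>2"
proof -
  let ?f = "quad_obj Q b" and ?a = nesterov_alpha
  have le: "?f xstar \<le> ?f z" for z
    using xstar by (auto simp: is_arg_min_def not_less)
  then have fs: "fstar = ?f xstar"
    unfolding fstar by (intro cInf_eq_minimum) auto
  obtain y where x0: "x 0 = x0" "y 1 = x0"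
    and min: "\<And>t. t \<ge> 1 \<Longrightarrow>
      is_arg_min (\<lambda>z. ?f z + 1/2 * (mat_norm S (z - y t))\<^sup>2) (\<lambda>_. True) (x t)"
    and y: "\<And>t. t \<ge> 1 \<Longrightarrow> y (t + 1) = (1 + (?a t - 1) / ?a (t + 1)) *\<^sub>R x t
            - ((?a t - 1) / ?a (t + 1)) *\<^sub>R x (t - 1)"
    using x unfolding nesterov_sequence_def by blast
  \<comment> \<open>At \<open>t = 0\<close> the truncated subtraction \<open>0 - 1 = 0\<close> and \<open>\<alpha> 0 = 0\<close> make \<open>u 0 = x0 - xstar\<close>.\<close>
  define u where "u t = ?a t *\<^sub>R x t - (?a t - 1) *\<^sub>R x (t - 1) - xstar" for t
  \<comment> \<open>The extrapolation coefficient is designed for this: \<open>u t\<close> serves as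
    the vector \<open>w\<close> of the next potential step.\<close>
  have u_y: "u t = ?a (Suc t) *\<^sub>R y (Suc t) - (?a (Suc t) - 1) *\<^sub>R x t - xstar" for t
  proof (cases "t = 0")
    case True
    then show ?thesis using x0 by (simp add: u_def)
  next
    case False
    have "?a (Suc t) \<noteq> 0" using nesterov_alpha_Suc_ge[of t] by auto
    then have "?a (Suc t) *\<^sub>R y (Suc t) =
        (?a (Suc t) + (?a t - 1)) *\<^sub>R x t - (?a t - 1) *\<^sub>R x (t - 1)"
      using y[of t] False by (simp add: scaleR_diff_right distrib_left)
    then show ?thesis by (simp add: u_def algebra_simps)
  qed
  have potential: "(?a t)\<^sup>2 * (?f (x t) - ?f xstar) + 1/2 * (u t \<bullet> (S *v u t))
      \<le> 1/2 * ((x0 - xstar) \<bullet> (S *v (x0 - xstar)))" for t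
  proof (induction t)
    case 0
    then show ?case using x0 by (simp add: u_def)
  next
    case (Suc t)
    have "1 \<le> ?a (Suc t)" using nesterov_alpha_Suc_ge[of t] by simp
    moreover have "u (Suc t) = ?a (Suc t) *\<^sub>R x (Suc t) - (?a (Suc t) - 1) *\<^sub>R x t - xstar"
      by (simp add: u_def)
    ultimately have "(?a (Suc t))\<^sup>2 * (?f (x (Suc t)) - ?f xstar) + 1/2 * (u (Suc t) \<bullet> (S *v u (Suc t)))
      \<le> ?a (Suc t) * (?a (Suc t) - 1) * (?f (x t) - ?f xstar) + 1/2 * (u t \<bullet> (S *v u t))"
      by (intro nesterov_potential_step[OF Q S _ min u_y]) auto
    with Suc show ?case by (simp only: nesterov_alpha_Suc_identity)
  qed
  show ?thesis
  proof (intro allI impI conjI)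
    fix t :: nat assume "1 \<le> t"
    then obtain k where k: "t = Suc k" by (cases t) auto
    show "0 \<le> ?f (x t) - fstar" using le by (simp add: fs)
    \<comment> \<open>With \<open>t = Suc k\<close>, the lower bound \<open>(real k + 2) / 2\<close>
      is \<open>(real t + 1) / 2\<close>.\<close>
    have "((real t + 1) / 2)\<^sup>2 \<le> (?a t)\<^sup>2"
      using nesterov_alpha_Suc_ge[of k] by (intro power_mono) (auto simp: k)
    then have "((real t + 1) / 2)\<^sup>2 * (?f (x t) - ?f xstar) \<le> (?a t)\<^sup>2 * (?f (x t) - ?f xstar)"
      using le[of "x t"] by (intro mult_right_mono) auto
    also have "\<dots> \<le> 1/2 * (mat_norm S (x0 - xstar))\<^sup>2"
      using potential[of t] sym_psd_nonneg[OF S, of "u t"] by (simp add: mat_norm_power2[OF S])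
    finally show "?f (x t) - fstar \<le> 2 * (mat_norm S (x0 - xstar))\<^sup>2 / (real t + 1)\<^sup>2"
      by (simp add: fs power_divide pos_le_divide_eq mult.commute)
  qed
qed

end
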